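(* Let $\hat{\mathbf x}_1,\hat{\mathbf x}_2,\hat{\mathbf x}_3$ be three finite points of $\mathrm P\mathbb R^2$ and $\mathbf l_1,\mathbf l_2$ two lines of $\mathrm P\mathbb R^2$ such that the three points and two lines are in general position, $\hat{\mathbf x}_i^T\mathbf l_1\neq0$ and $\hat{\mathbf x}_i^T\mathbf l_2\neq0$ for $i=1,2,3$, and the point $\mathbf p=\mathbf l_1\times\mathbf l_2$ does not lie on any side of the triangle $\hat{\mathbf x}_1\hat{\mathbf x}_2\hat{\mathbf x}_3$. Then the problem of determining a non-degenerate conic $\mathbf C$ such that $\hat{\mathbf x}_i^T\mathbf C\hat{\mathbf x}_i=0$ for $i=1,2,3$ and $\mathbf l_j^T\mathbf C^{-1}\mathbf l_j=0$ for $j=1,2$ has four distinct real solutions if and only if the signs of $(\hat{\mathbf x}_1^T\mathbf l_1)(\hat{\mathbf x}_1^T\mathbf l_2)$, $(\hat{\mathbf x}_2^T\mathbf l_1)(\hat{\mathbf x}_2^T\mathbf l_2)$, $(\hat{\mathbf x}_3^T\mathbf l_1)(\hat{\mathbf x}_3^T\mathbf l_2)$ are the same.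
   Context: $\mathrm P\mathbb R^2$ is the real projective plane. A hat denotes a finite point in normalized homogeneous coordinates, i.e. a vector of $\mathbb R^3$ whose third component is $1$. A line is given by a nonzero vector $\mathbf l\in\mathbb R^3$ (up to scale), and $\mathbf x$ lies on $\mathbf l$ iff $\mathbf x^T\mathbf l=0$; the two lines are distinct and the cross product $\mathbf l_1\times\mathbf l_2$ is their intersection point. A side of a triangle is the full line through two of its vertices. Three points and two lines are in general position if the three points are non-collinear, neither $\mathbf l_1$ nor $\mathbf l_2$ is a side of the triangle $\hat{\mathbf x}_1\hat{\mathbf x}_2\hat{\mathbf x}_3$, and the intersection point of $\mathbf l_1$ and $\mathbf l_2$ is not a vertex of that triangle. A conic is a nonzero symmetric $3\times3$ matrix (complex entries allowed) up to nonzero scale; it is non-degenerate if its determinant is nonzero and real if it can be represented by a real matrix. Solutions are counted up to scale. *)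

theory Defs
  imports "HOL-Analysis.Analysis"
begin

text \<open>Points and lines of the real projective plane are given by homogeneous coordinates, i.e.
  by nonzero vectors of \<^typ>\<open>real^3\<close> up to nonzero scale.\<close>

definition proj_eq :: "real^3 \<Rightarrow> real^3 \<Rightarrow> bool" where
  "proj_eq u v \<longleftrightarrow> (\<exists>c. c \<noteq> 0 \<and> v = c *\<^sub>R u)"

definition incident :: "real^3 \<Rightarrow> real^3 \<Rightarrow> bool" where
  "incident x l \<longleftrightarrow> x \<bullet> l = 0"

definition finite_point :: "real^3 \<Rightarrow> bool" where
  "finite_point x \<longleftrightarrow> x $ 3 = 1"

definition collinear_points :: "real^3 \<Rightarrow> real^3 \<Rightarrow> real^3 \<Rightarrow> bool" where
  "collinear_points x1 x2 x3 \<longleftrightarrow> (\<exists>l. l \<noteq> 0 \<and> incident x1 l \<and> incident x2 l \<and> incident x3 l)"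

definition is_side :: "real^3 \<Rightarrow> real^3 \<Rightarrow> real^3 \<Rightarrow> real^3 \<Rightarrow> bool" where
  "is_side l x1 x2 x3 \<longleftrightarrow> l \<noteq> 0 \<and>
     (incident x1 l \<and> incident x2 l \<or> incident x2 l \<and> incident x3 l \<or> incident x1 l \<and> incident x3 l)"

definition general_position :: "real^3 \<Rightarrow> real^3 \<Rightarrow> real^3 \<Rightarrow> real^3 \<Rightarrow> real^3 \<Rightarrow> bool" where
  "general_position x1 x2 x3 l1 l2 \<longleftrightarrow>
     \<not> collinear_points x1 x2 x3 \<and>
     \<not> is_side l1 x1 x2 x3 \<and> \<not> is_side l2 x1 x2 x3 \<and>
     \<not> proj_eq (cross3 l1 l2) x1 \<and> \<not> proj_eq (cross3 l1 l2) x2 \<and> \<not> proj_eq (cross3 l1 l2) x3"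

definition complex_vec :: "real^3 \<Rightarrow> complex^3" where
  "complex_vec x = (\<chi> i. complex_of_real (x $ i))"

definition conic_matrix :: "complex^3^3 \<Rightarrow> bool" where
  "conic_matrix C \<longleftrightarrow> C \<noteq> 0 \<and> transpose C = C"

definition conic_rel :: "((complex^3^3) \<times> (complex^3^3)) set" where
  "conic_rel = {(A, B). conic_matrix A \<and> conic_matrix B \<and> (\<exists>c. c \<noteq> 0 \<and> B = map_matrix ((*) c) A)}"

lemma equiv_conic_rel: "equiv (Collect conic_matrix) conic_rel"
proof (rule equivI)
  show "conic_rel \<subseteq> Collect conic_matrix \<times> Collect conic_matrix"
    by (auto simp: conic_rel_def)
  show "refl_on (Collect conic_matrix) conic_rel"
    by (auto simp: refl_on_def conic_rel_def vec_eq_iff intro!: exI[of _ 1])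
  show "sym conic_rel"
  proof (rule symI)
    fix A B assume "(A, B) \<in> conic_rel"
    then obtain c where "conic_matrix A" "conic_matrix B" "c \<noteq> 0" "B = map_matrix ((*) c) A"
      by (auto simp: conic_rel_def)
    then have "A = map_matrix ((*) (inverse c)) B" "inverse c \<noteq> 0"
      by (simp_all add: vec_eq_iff)
    then show "(B, A) \<in> conic_rel"
      using \<open>conic_matrix A\<close> \<open>conic_matrix B\<close> unfolding conic_rel_def by blast
  qed
  show "trans conic_rel"
  proof (rule transI)
    fix A B D assume "(A, B) \<in> conic_rel" "(B, D) \<in> conic_rel"
    then obtain c d where *: "conic_matrix A" "conic_matrix D" "c \<noteq> 0" "d \<noteq> 0"
        "B = map_matrix ((*) c) A" "D = map_matrix ((*) d) B"
      by (auto simp: conic_rel_def)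
    then have "D = map_matrix ((*) (d * c)) A" "d * c \<noteq> 0"
      by (simp_all add: vec_eq_iff)
    then show "(A, D) \<in> conic_rel"
      using * unfolding conic_rel_def by blast
  qed
qed

definition real_conic :: "complex^3^3 \<Rightarrow> bool" where
  "real_conic C \<longleftrightarrow> (\<exists>R :: real^3^3. (C, map_matrix complex_of_real R) \<in> conic_rel)"

definition nondegenerate :: "complex^3^3 \<Rightarrow> bool" where
  "nondegenerate C \<longleftrightarrow> det C \<noteq> 0"

text \<open>The forms below are bilinear, without complex conjugation, hence \<^const>\<open>scalar_product\<close>
  rather than \<^const>\<open>inner\<close>.  Tangency via \<^const>\<open>matrix_inv\<close> is meaningful only for
  invertible matrices; it is used below only for non-degenerate conics.\<close>

definition on_conic :: "real^3 \<Rightarrow> complex^3^3 \<Rightarrow> bool" where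
  "on_conic x C \<longleftrightarrow> scalar_product (complex_vec x) (C *v complex_vec x) = 0"

definition tangent_to :: "real^3 \<Rightarrow> complex^3^3 \<Rightarrow> bool" where
  "tangent_to l C \<longleftrightarrow> scalar_product (complex_vec l) (matrix_inv C *v complex_vec l) = 0"

definition conic_solution ::
  "real^3 \<Rightarrow> real^3 \<Rightarrow> real^3 \<Rightarrow> real^3 \<Rightarrow> real^3 \<Rightarrow> complex^3^3 \<Rightarrow> bool" where
  "conic_solution x1 x2 x3 l1 l2 C \<longleftrightarrow>
     conic_matrix C \<and> nondegenerate C \<and>
     on_conic x1 C \<and> on_conic x2 C \<and> on_conic x3 C \<and>
     tangent_to l1 C \<and> tangent_to l2 C"

definition real_solutions ::
  "real^3 \<Rightarrow> real^3 \<Rightarrow> real^3 \<Rightarrow> real^3 \<Rightarrow> real^3 \<Rightarrow> (complex^3^3) set set" where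
  "real_solutions x1 x2 x3 l1 l2 =
     {C. conic_solution x1 x2 x3 l1 l2 C \<and> real_conic C} // conic_rel"

end

theory Submission
  imports Defs
begin

text \<open>
  Take \<open>x\<^sub>1, x\<^sub>2, x\<^sub>3\<close> as a projective basis. The matrix of a conic through the three points then
  has zero diagonal, so the conic is a vector \<open>w\<close> of three off-diagonal entries, and it is
  non-degenerate exactly when no entry of \<open>w\<close> vanishes. A line whose values at the three points
  form the vector \<open>u\<close> is tangent to the conic iff the vector \<open>z\<close> of products \<open>z\<^sub>i = w\<^sub>i u\<^sub>i\<close> is a zero
  of the quadratic form
  \<open>Q z = z\<^sub>1\<^sup>2 + z\<^sub>2\<^sup>2 + z\<^sub>3\<^sup>2 - 2 z\<^sub>1 z\<^sub>2 - 2 z\<^sub>2 z\<^sub>3 - 2 z\<^sub>3 z\<^sub>1\<close> (lemma \<open>circumconic_tangent\<close>).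

  With \<open>z\<^sub>i = r\<^sub>i\<^sup>2\<close> the form is, up to sign, the product of the four linear forms
  \<open>r\<^sub>1 \<plusminus> r\<^sub>2 \<plusminus> r\<^sub>3\<close>. Hence the real zeros of
  \<open>Q\<close> without zero entries are, up to a common sign, the vectors of squares \<open>z\<^sub>i = s\<^sub>i\<^sup>2\<close> with
  \<open>s\<^sub>1 + s\<^sub>2 + s\<^sub>3 = 0\<close> (lemma \<open>inscribed_form_zero_imp_squares\<close>). In particular the entries of such a
  zero have the same sign.

  Let \<open>u\<close> and \<open>v\<close> be the vectors of values of the two lines. If a real solution \<open>w\<close> exists, then
  \<open>w\<^sub>i u\<^sub>i\<close> has a sign independent of \<open>i\<close>, and so has \<open>w\<^sub>i v\<^sub>i\<close>; multiplying, so has \<open>u\<^sub>i v\<^sub>i\<close>. Thus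
  already one real solution forces the sign condition (lemma \<open>common_tangent_signs\<close>).

  Conversely, if the signs agree, then \<open>v\<^sub>i = \<eta> \<mu>\<^sub>i\<^sup>2 u\<^sub>i\<close> with one sign \<open>\<eta>\<close> and positive \<open>\<mu>\<^sub>i\<close>. These are
  pairwise distinct because the intersection of the lines is on no side of the triangle. Writing
  \<open>w\<^sub>i u\<^sub>i = \<plusminus>s\<^sub>i\<^sup>2\<close>, the two tangency conditions become the linear equations \<open>s\<^sub>1 + s\<^sub>2 + s\<^sub>3 = 0\<close> and
  \<open>\<sigma>\<^sub>1 \<mu>\<^sub>1 s\<^sub>1 + \<sigma>\<^sub>2 \<mu>\<^sub>2 s\<^sub>2 + \<sigma>\<^sub>3 \<mu>\<^sub>3 s\<^sub>3 = 0\<close> for some signs \<open>\<sigma>\<^sub>i\<close>. Each of the four choices of \<open>\<sigma>\<close> up to a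
  global sign determines \<open>s\<close> up to scale, as the cross product of the two coefficient vectors, and
  different choices give different conics (lemmas \<open>tangent_imp_solution\<close> and \<open>solution_inj\<close>).
\<close>

section \<open>Real representatives of real conics\<close>

lemma matrix_inv_eqI:
  fixes A B :: "'a::field^'n^'n"
  assumes "A ** B = mat 1"
  shows "matrix_inv A = B"
  unfolding matrix_inv_def
proof (rule some_equality)
  show "A ** B = mat 1 \<and> B ** A = mat 1"
    using assms by (simp add: matrix_left_right_inverse)
  fix B' assume "A ** B' = mat 1 \<and> B' ** A = mat 1"
  then show "B' = B"
    using assms by (metis matrix_mul_assoc matrix_mul_lid matrix_mul_rid)
qed

lemma matrix_inv_nondegenerate:
  fixes A :: "'a::field^'n^'n"
  assumes "det A \<noteq> 0"
  shows "A ** matrix_inv A = mat 1" "matrix_inv A ** A = mat 1"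
proof -
  obtain B where "A ** B = mat 1" "B ** A = mat 1"
    using assms by (auto simp: invertible_det_nz[symmetric] invertible_def)
  then show "A ** matrix_inv A = mat 1" "matrix_inv A ** A = mat 1"
    by (simp_all add: matrix_inv_eqI)
qed

definition complexify :: "real^'n^'m \<Rightarrow> complex^'n^'m" where
  "complexify R = map_matrix complex_of_real R"

lemma complexify_component [simp]: "complexify R $ i $ j = complex_of_real (R$i$j)"
  by (simp add: complexify_def)

lemma complexify_eq_iff [simp]: "complexify R = complexify S \<longleftrightarrow> R = S"
  by (simp add: vec_eq_iff)

lemma complexify_eq_0_iff [simp]: "complexify R = 0 \<longleftrightarrow> R = 0"
  by (simp add: vec_eq_iff)

lemma complexify_mult: "complexify (A ** B) = complexify A ** complexify B"
  by (simp add: vec_eq_iff matrix_matrix_mult_def)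

lemma complexify_mat_1: "complexify (mat 1) = mat 1"
  by (simp add: vec_eq_iff mat_def)

lemma det_complexify: "det (complexify (R::real^3^3)) = complex_of_real (det R)"
  by (simp add: det_3)

lemma transpose_complexify: "transpose (complexify R) = complexify (transpose R)"
  by (simp add: vec_eq_iff transpose_def)

lemma matrix_inv_complexify:
  fixes R :: "real^3^3"
  assumes "det R \<noteq> 0"
  shows "matrix_inv (complexify R) = complexify (matrix_inv R)"
  using matrix_inv_nondegenerate[OF assms]
  by (intro matrix_inv_eqI) (simp add: complexify_mat_1 flip: complexify_mult)

lemma quadratic_form_complexify:
  "scalar_product (complex_vec x) (complexify R *v complex_vec x) = complex_of_real (x \<bullet> (R *v x))"
  by (simp add: scalar_product_def matrix_vector_mult_def complex_vec_def inner_vec_def)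

definition real_conic_solution ::
  "real^3 \<Rightarrow> real^3 \<Rightarrow> real^3 \<Rightarrow> real^3 \<Rightarrow> real^3 \<Rightarrow> real^3^3 \<Rightarrow> bool" where
  "real_conic_solution x1 x2 x3 l1 l2 R \<longleftrightarrow>
     transpose R = R \<and> det R \<noteq> 0 \<and>
     x1 \<bullet> (R *v x1) = 0 \<and> x2 \<bullet> (R *v x2) = 0 \<and> x3 \<bullet> (R *v x3) = 0 \<and>
     l1 \<bullet> (matrix_inv R *v l1) = 0 \<and> l2 \<bullet> (matrix_inv R *v l2) = 0"

lemma conic_solution_complexify:
  "conic_solution x1 x2 x3 l1 l2 (complexify R) \<longleftrightarrow> real_conic_solution x1 x2 x3 l1 l2 R"
proof (cases "det R = 0")
  case True
  then show ?thesis
    by (simp add: conic_solution_def real_conic_solution_def nondegenerate_def det_complexify)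
next
  case False
  then have "R \<noteq> 0" by (auto simp: det_3)
  with False show ?thesis
    by (simp add: conic_solution_def real_conic_solution_def nondegenerate_def det_complexify
        conic_matrix_def transpose_complexify on_conic_def tangent_to_def matrix_inv_complexify
        quadratic_form_complexify)
qed

lemma scalar_product_scaled_matrix:
  "scalar_product y (map_matrix ((*) c) A *v y) = c * scalar_product y (A *v y)"
  for c :: complex
  by (simp add: scalar_product_def matrix_vector_mult_def sum_distrib_left algebra_simps)

text \<open>All conditions on a conic are homogeneous: scaling the matrix by \<open>c\<close> scales its inverse by
  \<open>1 / c\<close>. This allows a real conic to be replaced by a real representative.\<close>

lemma conic_solution_scale:
  assumes C: "conic_solution x1 x2 x3 l1 l2 C" and rel: "(C, D) \<in> conic_rel"
  shows "conic_solution x1 x2 x3 l1 l2 D"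
proof -
  from rel obtain c where c: "c \<noteq> 0" "conic_matrix D" and D: "D = map_matrix ((*) c) C"
    by (auto simp: conic_rel_def)
  have det: "det C \<noteq> 0" using C by (simp add: conic_solution_def nondegenerate_def)
  have "det D = c ^ 3 * det C"
    by (simp add: D det_3 power3_eq_cube algebra_simps)
  with c det have "det D \<noteq> 0" by simp
  moreover have "matrix_inv D = map_matrix ((*) (inverse c)) (matrix_inv C)"
  proof (rule matrix_inv_eqI)
    have "D ** map_matrix ((*) (inverse c)) (matrix_inv C) = C ** matrix_inv C"
      using c(1) by (simp add: D vec_eq_iff matrix_matrix_mult_def field_simps)
    then show "D ** map_matrix ((*) (inverse c)) (matrix_inv C) = mat 1"
      using matrix_inv_nondegenerate[OF det] by simp
  qed
  ultimately show ?thesis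
    using C c by (simp add: conic_solution_def nondegenerate_def on_conic_def tangent_to_def
        scalar_product_scaled_matrix D)
qed

text \<open>Every real class contains a real matrix, so the count can be carried out among real matrices.\<close>

lemma real_solutions_eq:
  "real_solutions x1 x2 x3 l1 l2 =
     (\<lambda>R. conic_rel `` {complexify R}) ` {R. real_conic_solution x1 x2 x3 l1 l2 R}"
proof (intro equalityI subsetI)
  fix K assume "K \<in> real_solutions x1 x2 x3 l1 l2"
  then obtain C R where C: "conic_solution x1 x2 x3 l1 l2 C"
    and R: "(C, complexify R) \<in> conic_rel" and K: "K = conic_rel `` {C}"
    unfolding real_solutions_def quotient_def real_conic_def complexify_def by blast
  from R have "K = conic_rel `` {complexify R}"
    unfolding K by (rule equiv_class_eq[OF equiv_conic_rel])
  moreover have "real_conic_solution x1 x2 x3 l1 l2 R"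
    using conic_solution_scale[OF C R] by (simp add: conic_solution_complexify)
  ultimately show "K \<in> (\<lambda>R. conic_rel `` {complexify R}) ` {R. real_conic_solution x1 x2 x3 l1 l2 R}"
    by blast
next
  fix K assume "K \<in> (\<lambda>R. conic_rel `` {complexify R}) ` {R. real_conic_solution x1 x2 x3 l1 l2 R}"
  then obtain R where K: "K = conic_rel `` {complexify R}" and "real_conic_solution x1 x2 x3 l1 l2 R"
    by blast
  then have sol: "conic_solution x1 x2 x3 l1 l2 (complexify R)"
    by (simp add: conic_solution_complexify)
  then have "(complexify R, complexify R) \<in> conic_rel"
    using equiv_conic_rel by (auto simp: equiv_def refl_on_def conic_solution_def)
  then have "real_conic (complexify R)"
    unfolding real_conic_def complexify_def by blast
  with sol show "K \<in> real_solutions x1 x2 x3 l1 l2"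
    unfolding real_solutions_def K by (blast intro: quotientI)
qed

text \<open>A complex factor between two real matrices is real: compare a nonzero entry.\<close>

lemma complexify_conic_rel_iff:
  fixes R S :: "real^3^3"
  assumes "transpose R = R" "transpose S = S" "R \<noteq> 0"
  shows "(complexify R, complexify S) \<in> conic_rel \<longleftrightarrow> (\<exists>k. k \<noteq> 0 \<and> S = k *\<^sub>R R)"
proof
  assume "(complexify R, complexify S) \<in> conic_rel"
  then obtain c where c: "c \<noteq> 0" "complexify S = map_matrix ((*) c) (complexify R)"
    by (auto simp: conic_rel_def)
  then have S: "complex_of_real (S$i$j) = c * complex_of_real (R$i$j)" for i j
    by (metis complexify_component nth_map_matrix)
  from \<open>R \<noteq> 0\<close> obtain i j where "R$i$j \<noteq> 0" by (auto simp: vec_eq_iff)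
  then have k: "c = complex_of_real (S$i$j / R$i$j)" using S[of i j] by simp
  define k where "k = S$i$j / R$i$j"
  have "S$i$j = k * R$i$j" for i j
    using S[of i j] unfolding k k_def[symmetric] by (simp flip: of_real_mult)
  then have "S = k *\<^sub>R R" by (simp add: vec_eq_iff)
  moreover have "k \<noteq> 0" using c(1) unfolding k k_def by auto
  ultimately show "\<exists>k. k \<noteq> 0 \<and> S = k *\<^sub>R R" by blast
next
  assume "\<exists>k. k \<noteq> 0 \<and> S = k *\<^sub>R R"
  then obtain k where k: "k \<noteq> 0" "S = k *\<^sub>R R" by blast
  then have "complexify S = map_matrix ((*) (complex_of_real k)) (complexify R)"
    by (simp add: vec_eq_iff)
  moreover have "conic_matrix (complexify R)" "conic_matrix (complexify S)"
    using assms k by (simp_all add: conic_matrix_def transpose_complexify)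
  moreover have "complex_of_real k \<noteq> 0" using k(1) by simp
  ultimately show "(complexify R, complexify S) \<in> conic_rel"
    unfolding conic_rel_def by blast
qed

section \<open>Conics through the vertices of the triangle\<close>

text \<open>In the basis of the three vertices, a conic passes through a vertex iff the corresponding diagonal
  entry is zero. The entry indices are arranged so that \<open>w$i\<close> stands opposite to the \<open>i\<close>-th vertex.\<close>

definition circumconic :: "real^3 \<Rightarrow> real^3^3" where
  "circumconic w = vector [vector [0, w$3, w$2], vector [w$3, 0, w$1], vector [w$2, w$1, 0]]"

lemma circumconic_iff:
  "(\<exists>w. M = circumconic w) \<longleftrightarrow> transpose M = M \<and> (\<forall>i. M$i$i = 0)"
proof
  assume M: "transpose M = M \<and> (\<forall>i. M$i$i = 0)"
  have sym: "M$j$i = M$i$j" for i j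
  proof -
    have "M$j$i = transpose M $ i $ j" by (simp add: transpose_def)
    then show ?thesis using M by simp
  qed
  have "M = circumconic (vector [M$2$3, M$1$3, M$1$2])"
    unfolding circumconic_def vec_eq_iff forall_3
    using M sym[of 1 2] sym[of 1 3] sym[of 2 3] by (simp only: vector_3 simp_thms)
  then show "\<exists>w. M = circumconic w" ..
next
  assume "\<exists>w. M = circumconic w"
  then show "transpose M = M \<and> (\<forall>i. M$i$i = 0)"
    by (auto simp: circumconic_def vec_eq_iff forall_3 transpose_def)
qed

lemma det_circumconic: "det (circumconic w) = 2 * w$1 * w$2 * w$3"
  by (simp add: circumconic_def det_3)

lemma circumconic_scaleR: "circumconic (k *\<^sub>R w) = k *\<^sub>R circumconic w"
  by (simp add: circumconic_def vec_eq_iff forall_3)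

lemma circumconic_eq_iff: "circumconic w = circumconic w' \<longleftrightarrow> w = w'"
  by (auto simp: circumconic_def vec_eq_iff forall_3)

text \<open>The equation \<open>inscribed_form z = 0\<close> describes the conic inscribed in the coordinate triangle that
  touches each coordinate line at the point \<open>z\<^sub>i = z\<^sub>j\<close>, \<open>z\<^sub>k = 0\<close>.\<close>

definition inscribed_form :: "real^3 \<Rightarrow> real" where
  "inscribed_form z = (z$1)\<^sup>2 + (z$2)\<^sup>2 + (z$3)\<^sup>2 - 2*z$1*z$2 - 2*z$2*z$3 - 2*z$3*z$1"

text \<open>The adjugate of \<open>circumconic w\<close> has diagonal entries \<open>-w\<^sub>i\<^sup>2\<close> and off-diagonal entries \<open>w\<^sub>i w\<^sub>j\<close>; its
  value at \<open>m\<close> is therefore the negative of the inscribed form at the vector with entries \<open>w\<^sub>i m\<^sub>i\<close>.\<close>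

lemma circumconic_tangent:
  assumes "\<forall>i. w$i \<noteq> 0"
  shows "m \<bullet> (matrix_inv (circumconic w) *v m) = 0 \<longleftrightarrow> inscribed_form (w * m) = 0"
proof -
  define d where "d = 2 * w$1 * w$2 * w$3"
  have d: "d \<noteq> 0" using assms by (simp add: d_def)
  \<comment> \<open>the adjugate of \<open>circumconic w\<close>\<close>
  define N :: "real^3^3" where "N =
    vector [vector [- (w$1 * w$1), w$1 * w$2, w$1 * w$3],
            vector [w$1 * w$2, - (w$2 * w$2), w$2 * w$3],
            vector [w$1 * w$3, w$2 * w$3, - (w$3 * w$3)]]"
  have "circumconic w ** N = d *\<^sub>R mat 1"
    by (simp add: N_def d_def circumconic_def vec_eq_iff forall_3 matrix_matrix_mult_def sum_3 mat_def)
  then have "circumconic w ** ((1 / d) *\<^sub>R N) = mat 1"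
    using d by (simp add: matrix_scalar_ac flip: scalar_matrix_assoc)
  then have "matrix_inv (circumconic w) = (1 / d) *\<^sub>R N" by (rule matrix_inv_eqI)
  moreover have "m \<bullet> (((1 / d) *\<^sub>R N) *v m) = (1 / d) * (m \<bullet> (N *v m))"
    by (simp flip: scaleR_matrix_vector_assoc)
  moreover have "m \<bullet> (N *v m) = - inscribed_form (w * m)"
    by (simp add: N_def matrix_vector_mult_def inner_vec_def sum_3 inscribed_form_def
        algebra_simps power2_eq_square)
  ultimately show ?thesis using d by simp
qed

lemma quadratic_form_congruence:
  fixes P R :: "real^'n^'n"
  shows "x \<bullet> ((transpose P ** R ** P) *v x) = (P *v x) \<bullet> (R *v (P *v x))"
proof -
  have "(transpose P ** R ** P) *v x = (R *v (P *v x)) v* P"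
    by (simp only: transpose_matrix_vector flip: matrix_vector_mul_assoc)
  then show ?thesis
    by (metis dot_lmul_matrix inner_commute)
qed

lemma congruence_component:
  fixes X R :: "real^3^3"
  shows "(X ** R ** transpose X) $ i $ j = X$i \<bullet> (R *v X$j)"
  by (simp add: matrix_matrix_mult_def matrix_vector_mult_def transpose_def inner_vec_def sum_3 algebra_simps)

lemma congruence_eq_iff:
  fixes X :: "real^3^3"
  assumes X: "det X \<noteq> 0"
  shows "X ** R ** transpose X = M \<longleftrightarrow> R = matrix_inv X ** M ** transpose (matrix_inv X)"
proof -
  note inv = matrix_inv_nondegenerate[OF X]
  have tr: "transpose X ** transpose (matrix_inv X) = mat 1"
    "transpose (matrix_inv X) ** transpose X = mat 1"
    by (simp_all add: inv transpose_mat flip: matrix_transpose_mul)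
  have "matrix_inv X ** (X ** R ** transpose X) ** transpose (matrix_inv X)
      = (matrix_inv X ** X) ** R ** (transpose X ** transpose (matrix_inv X))"
    by (simp only: matrix_mul_assoc)
  moreover have "X ** (matrix_inv X ** M ** transpose (matrix_inv X)) ** transpose X
      = (X ** matrix_inv X) ** M ** (transpose (matrix_inv X) ** transpose X)"
    by (simp only: matrix_mul_assoc)
  ultimately show ?thesis by (auto simp: inv tr)
qed

text \<open>The tangency condition keeps its form in the basis of the rows of \<open>X\<close>: the value of the dual conic
  of \<open>R\<close> at \<open>l\<close> is the value of the dual conic of \<open>X ** R ** transpose X\<close> at \<open>X *v l\<close>.\<close>

lemma matrix_inv_congruence:
  fixes X R :: "real^'n^'n"
  assumes X: "det X \<noteq> 0" and R: "det R \<noteq> 0"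
  shows "matrix_inv R = transpose X ** matrix_inv (X ** R ** transpose X) ** X"
proof (rule matrix_inv_eqI)
  let ?M = "X ** R ** transpose X"
  have "det ?M \<noteq> 0" using X R by (simp add: det_mul)
  then have M: "?M ** matrix_inv ?M = mat 1" by (rule matrix_inv_nondegenerate)
  have "X ** (R ** (transpose X ** matrix_inv ?M ** X)) = ?M ** matrix_inv ?M ** X"
    by (simp only: matrix_mul_assoc)
  also have "\<dots> = X" by (simp add: M)
  finally have "matrix_inv X ** (X ** (R ** (transpose X ** matrix_inv ?M ** X))) = matrix_inv X ** X"
    by simp
  then show "R ** (transpose X ** matrix_inv ?M ** X) = mat 1"
    by (simp add: matrix_mul_assoc matrix_inv_nondegenerate[OF X])
qed

text \<open>The problem in the coordinates given by the triangle, whose vertices are the rows of \<open>X\<close>. The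
  vector \<open>X *v l\<close> consists of the values of the line \<open>l\<close> at the vertices.\<close>

lemma real_conic_solution_iff:
  fixes X :: "real^3^3"
  assumes X: "det X \<noteq> 0"
  shows "real_conic_solution (X$1) (X$2) (X$3) l1 l2 R \<longleftrightarrow>
    (\<exists>w. X ** R ** transpose X = circumconic w \<and> (\<forall>i. w$i \<noteq> 0) \<and>
         inscribed_form (w * (X *v l1)) = 0 \<and> inscribed_form (w * (X *v l2)) = 0)"
proof -
  let ?M = "X ** R ** transpose X"
  have sym: "transpose ?M = ?M \<longleftrightarrow> transpose R = R"
  proof -
    have "transpose ?M = X ** transpose R ** transpose X"
      by (simp add: matrix_transpose_mul matrix_mul_assoc)
    then show ?thesis
      using congruence_eq_iff[OF X, of "transpose R" ?M] congruence_eq_iff[OF X, of R ?M] by simp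
  qed
  have det: "det ?M \<noteq> 0 \<longleftrightarrow> det R \<noteq> 0" using X by (simp add: det_mul)
  have tangent: "l \<bullet> (matrix_inv R *v l) = 0 \<longleftrightarrow> inscribed_form (w * (X *v l)) = 0"
    if "?M = circumconic w" "det R \<noteq> 0" for w l
  proof -
    have "\<forall>i. w$i \<noteq> 0" using det that by (simp add: det_circumconic forall_3)
    then show ?thesis
      using that circumconic_tangent[of w "X *v l"]
      by (simp add: matrix_inv_congruence[OF X, of R] quadratic_form_congruence)
  qed
  have diag: "(\<forall>i. ?M$i$i = 0) \<longleftrightarrow>
      X$1 \<bullet> (R *v X$1) = 0 \<and> X$2 \<bullet> (R *v X$2) = 0 \<and> X$3 \<bullet> (R *v X$3) = 0"
    by (simp add: congruence_component forall_3)
  have nz: "(\<forall>i. w$i \<noteq> 0) \<longleftrightarrow> det R \<noteq> 0" if "?M = circumconic w" for w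
    using det that by (auto simp: det_circumconic forall_3)
  have "real_conic_solution (X$1) (X$2) (X$3) l1 l2 R \<longleftrightarrow>
    (\<exists>w. ?M = circumconic w) \<and> det R \<noteq> 0 \<and>
      l1 \<bullet> (matrix_inv R *v l1) = 0 \<and> l2 \<bullet> (matrix_inv R *v l2) = 0"
    unfolding circumconic_iff sym diag real_conic_solution_def by blast
  also have "\<dots> \<longleftrightarrow> (\<exists>w. ?M = circumconic w \<and> (\<forall>i. w$i \<noteq> 0) \<and>
      inscribed_form (w * (X *v l1)) = 0 \<and> inscribed_form (w * (X *v l2)) = 0)"
  proof
    assume *: "(\<exists>w. ?M = circumconic w) \<and> det R \<noteq> 0 \<and>
      l1 \<bullet> (matrix_inv R *v l1) = 0 \<and> l2 \<bullet> (matrix_inv R *v l2) = 0"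
    then obtain w where w: "?M = circumconic w" by blast
    from * tangent[OF w] nz[OF w]
    show "\<exists>w. ?M = circumconic w \<and> (\<forall>i. w$i \<noteq> 0) \<and>
      inscribed_form (w * (X *v l1)) = 0 \<and> inscribed_form (w * (X *v l2)) = 0"
      using w by blast
  next
    assume "\<exists>w. ?M = circumconic w \<and> (\<forall>i. w$i \<noteq> 0) \<and>
      inscribed_form (w * (X *v l1)) = 0 \<and> inscribed_form (w * (X *v l2)) = 0"
    then obtain w where w: "?M = circumconic w" "\<forall>i. w$i \<noteq> 0"
      "inscribed_form (w * (X *v l1)) = 0" "inscribed_form (w * (X *v l2)) = 0" by blast
    with tangent[OF w(1)] nz[OF w(1)]
    show "(\<exists>w. ?M = circumconic w) \<and> det R \<noteq> 0 \<and>
      l1 \<bullet> (matrix_inv R *v l1) = 0 \<and> l2 \<bullet> (matrix_inv R *v l2) = 0"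
      by blast
  qed
  finally show ?thesis .
qed

text \<open>The projective conic whose matrix in the basis of the rows of \<open>X\<close> is \<open>circumconic w\<close>.\<close>

definition conic_class :: "real^3^3 \<Rightarrow> real^3 \<Rightarrow> (complex^3^3) set" where
  "conic_class X w =
     conic_rel `` {complexify (matrix_inv X ** circumconic w ** transpose (matrix_inv X))}"

lemma real_solutions_coordinates:
  fixes X :: "real^3^3"
  assumes X: "det X \<noteq> 0"
  shows "real_solutions (X$1) (X$2) (X$3) l1 l2 =
    conic_class X ` {w. (\<forall>i. w$i \<noteq> 0) \<and>
      inscribed_form (w * (X *v l1)) = 0 \<and> inscribed_form (w * (X *v l2)) = 0}"
  unfolding real_solutions_eq real_conic_solution_iff[OF X] congruence_eq_iff[OF X] conic_class_def
  by blast

lemma conic_class_eq_iff: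
  fixes X :: "real^3^3"
  assumes X: "det X \<noteq> 0" and w: "\<forall>i. w$i \<noteq> 0" and w': "\<forall>i. w'$i \<noteq> 0"
  shows "conic_class X w = conic_class X w' \<longleftrightarrow> (\<exists>k. k \<noteq> 0 \<and> w' = k *\<^sub>R w)"
proof -
  let ?R = "\<lambda>w. matrix_inv X ** circumconic w ** transpose (matrix_inv X)"
  have R_eq: "X ** ?R w ** transpose X = circumconic w" for w
    by (simp add: congruence_eq_iff[OF X])
  have R_inj: "?R w = ?R w' \<longleftrightarrow> w = w'" for w w'
    using R_eq[of w] R_eq[of w'] by (metis circumconic_eq_iff)
  have R_scale: "k *\<^sub>R ?R w = ?R (k *\<^sub>R w)" for k w
    by (simp add: circumconic_scaleR matrix_scalar_ac scalar_matrix_assoc)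
  have sym: "transpose (?R w) = ?R w" for w
  proof -
    have "transpose (circumconic w) = circumconic w" using circumconic_iff by blast
    then show ?thesis by (simp add: matrix_transpose_mul matrix_mul_assoc)
  qed
  have nz: "?R w \<noteq> 0" if "\<forall>i. w$i \<noteq> 0" for w
  proof
    assume "?R w = 0"
    then have "circumconic w = X ** 0 ** transpose X" using R_eq[of w] by simp
    then have "det (circumconic w) = 0" by (simp add: det_3)
    then show False using that by (simp add: det_circumconic)
  qed
  have "conic_matrix (complexify (?R w))" "conic_matrix (complexify (?R w'))"
    using nz[OF w] nz[OF w'] by (simp_all add: conic_matrix_def transpose_complexify sym)
  then have "conic_class X w = conic_class X w' \<longleftrightarrow> (complexify (?R w), complexify (?R w')) \<in> conic_rel"
    unfolding conic_class_def by (simp add: eq_equiv_class_iff[OF equiv_conic_rel])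
  then show ?thesis
    unfolding complexify_conic_rel_iff[OF sym sym nz[OF w]] R_scale R_inj by blast
qed

section \<open>Real zeros of the inscribed form\<close>

text \<open>On a zero of the form, \<open>4 z\<^sub>i z\<^sub>j\<close> is the square \<open>(z\<^sub>i + z\<^sub>j - z\<^sub>k)\<^sup>2\<close>, which forces equal signs. After
  removing the common sign and taking square roots, the form is up to sign a product of four linear
  factors; the vanishing factor tells which signs to give to the square roots.\<close>

lemma inscribed_form_zero_imp_squares:
  assumes nz: "\<forall>i. z$i \<noteq> 0" and Q: "inscribed_form z = 0"
  obtains \<epsilon> :: real and s :: "real^3" where "\<epsilon> = 1 \<or> \<epsilon> = -1" "s$1 + s$2 + s$3 = 0" "\<forall>i. z$i = \<epsilon> * (s$i)\<^sup>2"
proof -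
  have "4 * (z$1 * z$2) = (z$1 + z$2 - z$3)\<^sup>2" "4 * (z$2 * z$3) = (z$2 + z$3 - z$1)\<^sup>2"
    using Q by (simp_all add: inscribed_form_def power2_eq_square algebra_simps)
  then have "z$1 * z$2 \<ge> 0" "z$2 * z$3 \<ge> 0"
    by (metis mult_nonneg_nonneg zero_le_power2 zero_le_mult_iff zero_less_numeral linorder_not_less order_less_le)+
  then have "z$1 * z$2 > 0" "z$2 * z$3 > 0"
    using nz by (simp_all add: order_le_less)
  \<comment> \<open>\<open>z\<^sub>2\<close> has the sign of both other entries\<close>
  then have same_sign: "(\<forall>i. z$i > 0) \<or> (\<forall>i. z$i < 0)"
    by (auto simp: forall_3 zero_less_mult_iff)
  define \<epsilon> :: real where "\<epsilon> = (if z$1 > 0 then 1 else -1)"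
  define r where "r i = sqrt \<bar>z$i\<bar>" for i
  have z_eq: "z$i = \<epsilon> * (r i)\<^sup>2" for i
  proof -
    have "z$i = \<epsilon> * \<bar>z$i\<bar>"
    proof (cases "z$1 > 0")
      case True
      then have "\<not> z$1 < 0" by simp
      then have "z$i > 0" using same_sign by blast
      then show ?thesis using True unfolding \<epsilon>_def by (simp only: if_True abs_of_pos mult_1)
    next
      case False
      then have "z$i < 0" using same_sign by blast
      then show ?thesis using False unfolding \<epsilon>_def by (simp only: if_False abs_of_neg mult_minus1 minus_minus)
    qed
    then show ?thesis unfolding r_def by (simp only: real_sqrt_pow2 abs_ge_zero)
  qed
  have "(r 1 + r 2 + r 3) * (r 1 + r 2 - r 3) * (r 1 - r 2 + r 3) * (- r 1 + r 2 + r 3) = - inscribed_form z"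
    (is "?product = _")
  proof -
    have "inscribed_form z = \<epsilon>\<^sup>2 * - ?product"
      unfolding inscribed_form_def z_eq by (simp only: power2_eq_square) algebra
    then show ?thesis by (simp add: \<epsilon>_def)
  qed
  then consider "r 1 + r 2 + r 3 = 0" | "r 1 + r 2 - r 3 = 0" | "r 1 - r 2 + r 3 = 0" | "- r 1 + r 2 + r 3 = 0"
    using Q by auto
  then have "\<exists>s::real^3. s$1 + s$2 + s$3 = 0 \<and> (\<forall>i. (s$i)\<^sup>2 = (r i)\<^sup>2)"
  proof cases
    case 1 then show ?thesis by (intro exI[of _ "vector [r 1, r 2, r 3]"]) (simp add: forall_3)
  next
    case 2 then show ?thesis by (intro exI[of _ "vector [r 1, r 2, - r 3]"]) (simp add: forall_3)
  next
    case 3 then show ?thesis by (intro exI[of _ "vector [r 1, - r 2, r 3]"]) (simp add: forall_3)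
  next
    case 4 then show ?thesis by (intro exI[of _ "vector [- r 1, r 2, r 3]"]) (simp add: forall_3)
  qed
  then obtain s :: "real^3" where "s$1 + s$2 + s$3 = 0" "\<forall>i. (s$i)\<^sup>2 = (r i)\<^sup>2" by blast
  moreover have "\<epsilon> = 1 \<or> \<epsilon> = -1" by (simp add: \<epsilon>_def)
  ultimately show thesis
    by (intro that[of \<epsilon> s]) (simp_all add: z_eq)
qed

lemma inscribed_form_squares:
  fixes s :: "real^3"
  assumes "s$1 + s$2 + s$3 = 0" and "\<forall>i. z$i = c * (s$i)\<^sup>2"
  shows "inscribed_form z = 0"
proof -
  have "s$3 = - s$1 - s$2" using assms(1) by simp
  then have "z$1 = c * (s$1)\<^sup>2" "z$2 = c * (s$2)\<^sup>2" "z$3 = c * (- s$1 - s$2)\<^sup>2"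
    using assms(2) by simp_all
  then show ?thesis
    unfolding inscribed_form_def by (simp only:) (simp add: power2_eq_square algebra_simps)
qed

text \<open>Both \<open>w * u\<close> and \<open>w * v\<close> have entries of constant sign, hence so has their product, and the
  squares \<open>w\<^sub>i\<^sup>2\<close> do not affect signs.\<close>

lemma common_tangent_signs:
  assumes nz: "\<forall>i. w$i \<noteq> 0" "\<forall>i. u$i \<noteq> 0" "\<forall>i. v$i \<noteq> 0"
    and Q: "inscribed_form (w * u) = 0" "inscribed_form (w * v) = 0"
  shows "sgn (u$i * v$i) = sgn (u$j * v$j)"
proof -
  have nz': "\<forall>i. (w * u)$i \<noteq> 0" "\<forall>i. (w * v)$i \<noteq> 0" using nz by simp_all
  obtain \<epsilon> s where \<epsilon>: "\<epsilon> = 1 \<or> \<epsilon> = -1" and s: "\<forall>i. (w * u)$i = \<epsilon> * (s$i)\<^sup>2"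
    using inscribed_form_zero_imp_squares[OF nz'(1) Q(1)] by metis
  obtain \<delta> t where \<delta>: "\<delta> = 1 \<or> \<delta> = -1" and t: "\<forall>i. (w * v)$i = \<delta> * (t$i)\<^sup>2"
    using inscribed_form_zero_imp_squares[OF nz'(2) Q(2)] by metis
  have "sgn (u$i * v$i) = \<epsilon> * \<delta>" for i
  proof -
    have "s$i \<noteq> 0" "t$i \<noteq> 0"
      using s[THEN spec, of i] t[THEN spec, of i] nz by auto
    have "sgn (u$i * v$i) = sgn ((w$i)\<^sup>2 * (u$i * v$i))"
    proof -
      have "(w$i)\<^sup>2 > 0" using nz by simp
      then show ?thesis by (simp only: sgn_mult sgn_pos mult_1)
    qed
    also have "(w$i)\<^sup>2 * (u$i * v$i) = (w * u)$i * (w * v)$i"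
      by (simp add: power2_eq_square)
    also have "\<dots> = (\<epsilon> * \<delta>) * (s$i * t$i)\<^sup>2"
      using s t by (simp only: power_mult_distrib mult_ac)
    also have "sgn \<dots> = \<epsilon> * \<delta>"
    proof -
      have "(s$i * t$i)\<^sup>2 > 0" using \<open>s$i \<noteq> 0\<close> \<open>t$i \<noteq> 0\<close> by simp
      then have "sgn ((\<epsilon> * \<delta>) * (s$i * t$i)\<^sup>2) = sgn (\<epsilon> * \<delta>)"
        by (simp only: sgn_mult[of "\<epsilon> * \<delta>"] sgn_pos mult_1_right)
      then show ?thesis using \<epsilon> \<delta> by auto
    qed
    finally show ?thesis .
  qed
  then show ?thesis by simp
qed

section \<open>The four common solutions\<close>

text \<open>Representatives of the eight vectors of signs modulo a global sign.\<close>

definition sign_vectors :: "(real^3) set" where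
  "sign_vectors = {vector [1, 1, 1], vector [-1, 1, 1], vector [1, -1, 1], vector [1, 1, -1]}"

lemma sign_vectors_cases:
  assumes "\<forall>i. (\<tau>::real^3)$i = 1 \<or> \<tau>$i = -1"
  shows "\<tau> \<in> sign_vectors \<or> - \<tau> \<in> sign_vectors"
  using assms unfolding sign_vectors_def by (auto simp: forall_3 vec_eq_iff)

lemma sign_vectors_abs:
  assumes "\<sigma> \<in> sign_vectors" shows "(\<sigma>$i)\<^sup>2 = 1"
  using assms exhaust_3[of i] by (auto simp: sign_vectors_def)

lemma card_sign_vectors: "card sign_vectors = 4"
  by (simp add: sign_vectors_def vec_eq_iff forall_3)

text \<open>Two lines with values \<open>u\<close> and \<open>v\<close> at the vertices satisfying the sign condition. The ratios
  \<open>v\<^sub>i / u\<^sub>i\<close> share the sign \<open>\<eta>\<close>, and \<open>\<mu>\<^sub>i\<close> is the positive number whose square is the absolute value of the ratio.\<close>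

locale common_tangents =
  fixes u v \<mu> :: "real^3" and \<eta> :: real
  assumes u_nz: "u$i \<noteq> 0"
    and \<eta>: "\<eta> = 1 \<or> \<eta> = -1"
    and \<mu>_pos: "\<mu>$i > 0"
    and \<mu>_inj: "i \<noteq> j \<Longrightarrow> \<mu>$i \<noteq> \<mu>$j"
    and v_eq: "v$i = \<eta> * (\<mu>$i)\<^sup>2 * u$i"
begin

text \<open>The solution, up to scale, of the linear equations \<open>s\<^sub>1 + s\<^sub>2 + s\<^sub>3 = 0\<close> and
  \<open>\<sigma>\<^sub>1 \<mu>\<^sub>1 s\<^sub>1 + \<sigma>\<^sub>2 \<mu>\<^sub>2 s\<^sub>2 + \<sigma>\<^sub>3 \<mu>\<^sub>3 s\<^sub>3 = 0\<close>. Here \<open>1\<close> is the vector with all entries one.\<close>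

definition sqrt_vector :: "real^3 \<Rightarrow> real^3" where
  "sqrt_vector \<sigma> = cross3 1 (\<sigma> * \<mu>)"

definition solution :: "real^3 \<Rightarrow> real^3" where
  "solution \<sigma> = (\<chi> i. (sqrt_vector \<sigma> $ i)\<^sup>2 / u$i)"

lemma sqrt_vector_components:
  "sqrt_vector \<sigma> $ 1 = \<sigma>$3 * \<mu>$3 - \<sigma>$2 * \<mu>$2"
  "sqrt_vector \<sigma> $ 2 = \<sigma>$1 * \<mu>$1 - \<sigma>$3 * \<mu>$3"
  "sqrt_vector \<sigma> $ 3 = \<sigma>$2 * \<mu>$2 - \<sigma>$1 * \<mu>$1"
  by (simp_all add: sqrt_vector_def cross3_def)

lemma sqrt_vector_relations:
  "sqrt_vector \<sigma> $ 1 + sqrt_vector \<sigma> $ 2 + sqrt_vector \<sigma> $ 3 = 0"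
  "\<sigma>$1 * \<mu>$1 * sqrt_vector \<sigma> $ 1 + \<sigma>$2 * \<mu>$2 * sqrt_vector \<sigma> $ 2 + \<sigma>$3 * \<mu>$3 * sqrt_vector \<sigma> $ 3 = 0"
  by (simp_all add: sqrt_vector_components algebra_simps)

text \<open>The entries are differences \<open>\<sigma>\<^sub>i \<mu>\<^sub>i - \<sigma>\<^sub>j \<mu>\<^sub>j\<close>, and the \<open>\<mu>\<^sub>i\<close> are distinct and positive.\<close>

lemma sqrt_vector_nonzero:
  assumes "\<sigma> \<in> sign_vectors" shows "sqrt_vector \<sigma> $ i \<noteq> 0"
proof -
  have "\<sigma>$i * \<mu>$i \<noteq> \<sigma>$j * \<mu>$j" if "i \<noteq> j" for i j
  proof
    assume "\<sigma>$i * \<mu>$i = \<sigma>$j * \<mu>$j"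
    then have "(\<mu>$i)\<^sup>2 = (\<mu>$j)\<^sup>2"
      using sign_vectors_abs[OF assms] by (metis mult_1 power_mult_distrib)
    with \<mu>_inj[OF that] \<mu>_pos show False
      by (meson less_imp_le power2_eq_imp_eq)
  qed
  from this[of 1 2] this[of 2 3] this[of 3 1] show ?thesis
    using exhaust_3[of i] by (auto simp: sqrt_vector_components)
qed

lemma solution_nonzero: "\<sigma> \<in> sign_vectors \<Longrightarrow> solution \<sigma> $ i \<noteq> 0"
  by (simp add: solution_def sqrt_vector_nonzero u_nz)

lemma tangent_solution:
  assumes "\<sigma> \<in> sign_vectors"
  shows "inscribed_form (k *\<^sub>R solution \<sigma> * u) = 0" "inscribed_form (k *\<^sub>R solution \<sigma> * v) = 0"
proof -
  show "inscribed_form (k *\<^sub>R solution \<sigma> * u) = 0"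
    by (rule inscribed_form_squares[of "sqrt_vector \<sigma>" _ k])
       (simp_all add: sqrt_vector_relations solution_def u_nz)
  show "inscribed_form (k *\<^sub>R solution \<sigma> * v) = 0"
    by (rule inscribed_form_squares[of "\<sigma> * \<mu> * sqrt_vector \<sigma>" _ "k * \<eta>"])
       (simp_all add: sqrt_vector_relations solution_def u_nz v_eq power_mult_distrib
         sign_vectors_abs[OF assms])
qed

text \<open>Tangency to the two lines gives two vectors \<open>s\<close> and \<open>t\<close> with entry sum zero whose squares differ by
  the factors \<open>\<mu>\<^sub>i\<^sup>2\<close>. So \<open>t\<^sub>i\<close> equals \<open>\<mu>\<^sub>i s\<^sub>i\<close> up to a sign, and \<open>s\<close> satisfies the linear equations
  that determine it up to scale.\<close>

lemma tangent_imp_solution: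
  assumes w: "\<forall>i. w$i \<noteq> 0" and Qu: "inscribed_form (w * u) = 0" and Qv: "inscribed_form (w * v) = 0"
  obtains k \<sigma> where "k \<noteq> 0" "\<sigma> \<in> sign_vectors" "w = k *\<^sub>R solution \<sigma>"
proof -
  have "\<mu>$i \<noteq> 0" for i using \<mu>_pos[of i] by simp
  then have v_nz: "v$i \<noteq> 0" for i using \<eta> by (auto simp: v_eq u_nz)
  obtain \<epsilon> s where \<epsilon>: "\<epsilon> = 1 \<or> \<epsilon> = -1" and s_sum: "s$1 + s$2 + s$3 = 0"
    and s: "\<forall>i. (w * u)$i = \<epsilon> * (s$i)\<^sup>2"
    using inscribed_form_zero_imp_squares[OF _ Qu] w u_nz by auto
  obtain \<delta> t where \<delta>: "\<delta> = 1 \<or> \<delta> = -1" and t_sum: "t$1 + t$2 + t$3 = 0"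
    and t: "\<forall>i. (w * v)$i = \<delta> * (t$i)\<^sup>2"
    using inscribed_form_zero_imp_squares[OF _ Qv] w v_nz by auto
  have s_nz: "s$i \<noteq> 0" for i
    using s[THEN spec, of i] w u_nz[of i] by auto
  have "\<exists>\<tau>. (\<tau> = 1 \<or> \<tau> = -1) \<and> t$i = \<tau> * (\<mu>$i * s$i)" for i
  proof -
    have "\<delta> * (t$i)\<^sup>2 = \<eta> * \<epsilon> * (\<mu>$i * s$i)\<^sup>2"
    proof -
      have "\<delta> * (t$i)\<^sup>2 = \<eta> * (\<mu>$i)\<^sup>2 * (w * u)$i"
        using t[THEN spec, of i] by (simp add: v_eq ac_simps)
      also have "\<dots> = \<eta> * \<epsilon> * (\<mu>$i * s$i)\<^sup>2"
        using s by (simp add: power_mult_distrib)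
      finally show ?thesis .
    qed
    moreover have "(\<mu>$i * s$i)\<^sup>2 > 0" "(t$i)\<^sup>2 \<ge> 0"
      using s_nz[of i] \<mu>_pos[of i] by simp_all
    ultimately have "(t$i)\<^sup>2 = (\<mu>$i * s$i)\<^sup>2"
      using \<epsilon> \<delta> \<eta> by (elim disjE; hypsubst; linarith)
    then show ?thesis
      by (metis mult_1 mult_minus1 power2_eq_iff)
  qed
  then obtain \<tau>' where \<tau>': "\<And>i. \<tau>' i = 1 \<or> \<tau>' i = -1" "\<And>i. t$i = \<tau>' i * (\<mu>$i * s$i)"
    by metis
  define \<tau> :: "real^3" where "\<tau> = (\<chi> i. \<tau>' i)"
  have \<tau>_sign: "\<forall>i. \<tau>$i = 1 \<or> \<tau>$i = -1" using \<tau>'(1) by (simp add: \<tau>_def)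
  have \<tau>_sum: "\<tau>$1 * \<mu>$1 * s$1 + \<tau>$2 * \<mu>$2 * s$2 + \<tau>$3 * \<mu>$3 * s$3 = 0"
    using t_sum by (simp add: \<tau>'(2) \<tau>_def mult.assoc)
  \<comment> \<open>the linear equation is insensitive to a global sign of the sign vector\<close>
  obtain \<sigma> where \<sigma>: "\<sigma> \<in> sign_vectors"
    and \<sigma>_sum: "\<sigma>$1 * \<mu>$1 * s$1 + \<sigma>$2 * \<mu>$2 * s$2 + \<sigma>$3 * \<mu>$3 * s$3 = 0"
  proof (cases "\<tau> \<in> sign_vectors")
    case True then show ?thesis using that \<tau>_sum by blast
  next
    case False
    then have "- \<tau> \<in> sign_vectors" using sign_vectors_cases[OF \<tau>_sign] by blast
    then show ?thesis using that[of "- \<tau>"] \<tau>_sum by simp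
  qed
  define k where "k = s$3 / sqrt_vector \<sigma> $ 3"
  have s3: "s$3 = k * sqrt_vector \<sigma> $ 3" by (simp add: k_def sqrt_vector_nonzero[OF \<sigma>])
  have s1: "s$1 = - s$2 - s$3" using s_sum by simp
  have "s$2 * sqrt_vector \<sigma> $ 3 = s$3 * sqrt_vector \<sigma> $ 2"
    using \<sigma>_sum unfolding s1 sqrt_vector_components by (simp add: algebra_simps)
  then have s2: "s$2 = k * sqrt_vector \<sigma> $ 2"
    by (simp add: k_def sqrt_vector_nonzero[OF \<sigma>] field_simps)
  have "s$1 = k * sqrt_vector \<sigma> $ 1"
    unfolding s1 s2 s3 by (simp add: sqrt_vector_components algebra_simps)
  with s2 s3 have "s$i = k * sqrt_vector \<sigma> $ i" for i using exhaust_3[of i] by auto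
  then have "w = (\<epsilon> * k\<^sup>2) *\<^sub>R solution \<sigma>"
    using s by (simp add: vec_eq_iff solution_def u_nz field_simps power_mult_distrib)
  moreover have "\<epsilon> * k\<^sup>2 \<noteq> 0"
    using \<epsilon> s3 s_nz[of 3] by auto
  ultimately show thesis using that \<sigma> by blast
qed

text \<open>If two sign vectors give proportional solutions, then their square roots \<open>g\<close> and \<open>h\<close> agree up to
  a factor and individual signs. Both have entry sum zero and no zero entry, so all these signs
  agree and \<open>g\<close>, \<open>h\<close> are proportional. Then \<open>g\<close> satisfies the linear equations of both sign vectors;
  adding or subtracting these leaves a single nonzero term unless the sign vectors are equal.\<close>

lemma solution_inj:
  assumes \<sigma>: "\<sigma> \<in> sign_vectors" and \<sigma>': "\<sigma>' \<in> sign_vectors"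
    and eq: "solution \<sigma>' = k *\<^sub>R solution \<sigma>"
  shows "\<sigma>' = \<sigma>"
proof -
  let ?g = "sqrt_vector \<sigma>" and ?h = "sqrt_vector \<sigma>'"
  have sq: "(?h$i)\<^sup>2 = k * (?g$i)\<^sup>2" for i
    using arg_cong[OF eq, of "\<lambda>x. x$i"] by (simp add: solution_def u_nz)
  have "k > 0"
    using sq[of 1] sqrt_vector_nonzero[OF \<sigma>, of 1] sqrt_vector_nonzero[OF \<sigma>', of 1]
    by (metis zero_less_mult_pos2 zero_less_power2)
  define c where "c = sqrt k"
  have "c > 0" using \<open>k > 0\<close> by (simp add: c_def)
  have "k = c\<^sup>2" using \<open>k > 0\<close> by (simp add: c_def)
  then have "(?h$i)\<^sup>2 = (c * ?g$i)\<^sup>2" for i by (simp add: sq power_mult_distrib)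
  then have pm: "?h$i = c * ?g$i \<or> ?h$i = - (c * ?g$i)" for i
    by (simp add: power2_eq_iff)
  have nz: "c * ?g$1 \<noteq> 0" "c * ?g$2 \<noteq> 0" "c * ?g$3 \<noteq> 0"
    using \<open>c > 0\<close> sqrt_vector_nonzero[OF \<sigma>] by simp_all
  have "c * ?g$1 + c * ?g$2 + c * ?g$3 = 0"
    using sqrt_vector_relations(1)[of \<sigma>] by (simp flip: distrib_left)
  then have "(\<forall>i. ?h$i = c * ?g$i) \<or> (\<forall>i. ?h$i = - (c * ?g$i))"
    using pm[of 1] pm[of 2] pm[of 3] nz sqrt_vector_relations(1)[of \<sigma>'] unfolding forall_3
    by argo
  then obtain d where "d \<noteq> 0" "\<And>i. ?h$i = d * ?g$i"
    using \<open>c > 0\<close> by (metis less_irrefl minus_mult_left neg_equal_0_iff_equal)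
  then have d: "d * (\<sigma>'$1 * \<mu>$1 * ?g$1 + \<sigma>'$2 * \<mu>$2 * ?g$2 + \<sigma>'$3 * \<mu>$3 * ?g$3) = 0"
    using sqrt_vector_relations(2)[of \<sigma>'] by (simp add: algebra_simps)
  define p q r where "p = \<mu>$1 * ?g$1" and "q = \<mu>$2 * ?g$2" and "r = \<mu>$3 * ?g$3"
  have "\<sigma>'$1 * p + \<sigma>'$2 * q + \<sigma>'$3 * r = 0"
    using d \<open>d \<noteq> 0\<close> by (simp add: p_def q_def r_def mult.assoc)
  moreover have "\<sigma>$1 * p + \<sigma>$2 * q + \<sigma>$3 * r = 0"
    using sqrt_vector_relations(2)[of \<sigma>] by (simp add: p_def q_def r_def mult.assoc)
  moreover have "p \<noteq> 0" "q \<noteq> 0" "r \<noteq> 0"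
    using \<mu>_pos[of 1] \<mu>_pos[of 2] \<mu>_pos[of 3] sqrt_vector_nonzero[OF \<sigma>]
    by (simp_all add: p_def q_def r_def)
  ultimately show ?thesis
    using \<sigma> \<sigma>' unfolding sign_vectors_def
    by (elim insertE emptyE; simp; argo)
qed

end

section \<open>Counting the real solutions\<close>

text \<open>The hypothesis on the minors of \<open>u\<close> and \<open>v\<close> says that the ratios \<open>v\<^sub>i / u\<^sub>i\<close> are distinct, which
  makes the square roots of their absolute values distinct because the ratios have equal signs.\<close>

lemma card_real_solutions_eq_4:
  fixes X :: "real^3^3" and l1 l2 :: "real^3"
  defines "u \<equiv> X *v l1" and "v \<equiv> X *v l2"
  assumes X: "det X \<noteq> 0" and u_nz: "\<forall>i. u$i \<noteq> 0" and v_nz: "\<forall>i. v$i \<noteq> 0"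
    and minors: "\<forall>i j. i \<noteq> j \<longrightarrow> u$i * v$j \<noteq> u$j * v$i"
    and signs: "\<And>i j. sgn (u$i * v$i) = sgn (u$j * v$j)"
  shows "card (real_solutions (X$1) (X$2) (X$3) l1 l2) = 4"
proof -
  define \<eta> where "\<eta> = sgn (u$1 * v$1)"
  define \<mu> :: "real^3" where "\<mu> = (\<chi> i. sqrt \<bar>v$i / u$i\<bar>)"
  have \<eta>: "\<eta> = 1 \<or> \<eta> = -1"
    using u_nz v_nz by (auto simp: \<eta>_def sgn_if)
  have ratio: "\<eta> * (\<mu>$i)\<^sup>2 = v$i / u$i" for i
  proof -
    have "\<eta> = sgn (v$i / u$i)"
      using signs[of 1 i] by (simp add: \<eta>_def sgn_mult sgn_divide)
    moreover have "(\<mu>$i)\<^sup>2 = \<bar>v$i / u$i\<bar>" by (simp add: \<mu>_def)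
    ultimately show ?thesis by (simp only: sgn_mult_abs)
  qed
  interpret common_tangents u v \<mu> \<eta>
  proof
    show "u$i \<noteq> 0" for i using u_nz by blast
    show "\<eta> = 1 \<or> \<eta> = -1" by (fact \<eta>)
    show "\<mu>$i > 0" for i using u_nz v_nz by (simp add: \<mu>_def)
    show "v$i = \<eta> * (\<mu>$i)\<^sup>2 * u$i" for i using u_nz by (simp add: ratio)
    show "\<mu>$i \<noteq> \<mu>$j" if "i \<noteq> j" for i j
    proof
      assume "\<mu>$i = \<mu>$j"
      then have "v$i / u$i = v$j / u$j" by (metis ratio)
      then show False using minors that u_nz by (simp add: frac_eq_eq mult.commute)
    qed
  qed
  let ?W = "{w. (\<forall>i. w$i \<noteq> 0) \<and> inscribed_form (w * u) = 0 \<and> inscribed_form (w * v) = 0}"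
  have class_solution: "conic_class X (k *\<^sub>R solution \<sigma>) = conic_class X (solution \<sigma>)"
    if "\<sigma> \<in> sign_vectors" "k \<noteq> 0" for k \<sigma>
    using conic_class_eq_iff[OF X, of "solution \<sigma>" "k *\<^sub>R solution \<sigma>"] solution_nonzero that
    by fastforce
  have "conic_class X ` ?W = (\<lambda>\<sigma>. conic_class X (solution \<sigma>)) ` sign_vectors"
  proof (intro equalityI subsetI)
    fix K assume "K \<in> conic_class X ` ?W"
    then obtain w where K: "K = conic_class X w" and w: "\<forall>i. w$i \<noteq> 0"
      "inscribed_form (w * u) = 0" "inscribed_form (w * v) = 0" by blast
    obtain k \<sigma> where "k \<noteq> 0" "\<sigma> \<in> sign_vectors" "w = k *\<^sub>R solution \<sigma>"
      using tangent_imp_solution[OF w] by blast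
    then show "K \<in> (\<lambda>\<sigma>. conic_class X (solution \<sigma>)) ` sign_vectors"
      using class_solution K by blast
  next
    fix K assume "K \<in> (\<lambda>\<sigma>. conic_class X (solution \<sigma>)) ` sign_vectors"
    then obtain \<sigma> where "\<sigma> \<in> sign_vectors" "K = conic_class X (solution \<sigma>)" by blast
    moreover from this have "solution \<sigma> \<in> ?W"
      using tangent_solution[of \<sigma> 1] solution_nonzero by simp
    ultimately show "K \<in> conic_class X ` ?W" by blast
  qed
  moreover have "inj_on (\<lambda>\<sigma>. conic_class X (solution \<sigma>)) sign_vectors"
  proof (rule inj_onI)
    fix \<sigma> \<sigma>' assume \<sigma>: "\<sigma> \<in> sign_vectors" "\<sigma>' \<in> sign_vectors"
      and "conic_class X (solution \<sigma>) = conic_class X (solution \<sigma>')"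
    then obtain k where "solution \<sigma>' = k *\<^sub>R solution \<sigma>"
      using conic_class_eq_iff[OF X] solution_nonzero by metis
    then show "\<sigma> = \<sigma>'" using solution_inj \<sigma> by blast
  qed
  ultimately show ?thesis
    unfolding real_solutions_coordinates[OF X]
    by (simp add: card_image card_sign_vectors flip: u_def v_def)
qed

theorem proposition3:
  fixes x1 x2 x3 l1 l2 :: "real^3"
  assumes "finite_point x1" and "finite_point x2" and "finite_point x3"
    and "l1 \<noteq> 0" and "l2 \<noteq> 0" and "\<not> proj_eq l1 l2"
    and "general_position x1 x2 x3 l1 l2"
    and "x1 \<bullet> l1 \<noteq> 0" and "x2 \<bullet> l1 \<noteq> 0" and "x3 \<bullet> l1 \<noteq> 0"
    and "x1 \<bullet> l2 \<noteq> 0" and "x2 \<bullet> l2 \<noteq> 0" and "x3 \<bullet> l2 \<noteq> 0"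
    and "\<And>s. is_side s x1 x2 x3 \<Longrightarrow> \<not> incident (cross3 l1 l2) s"
  shows "card (real_solutions x1 x2 x3 l1 l2) = 4 \<longleftrightarrow>
    sgn ((x1 \<bullet> l1) * (x1 \<bullet> l2)) = sgn ((x2 \<bullet> l1) * (x2 \<bullet> l2)) \<and>
    sgn ((x2 \<bullet> l1) * (x2 \<bullet> l2)) = sgn ((x3 \<bullet> l1) * (x3 \<bullet> l2))"
proof -
  define X :: "real^3^3" where "X = vector [x1, x2, x3]"
  have X_rows: "X$1 = x1" "X$2 = x2" "X$3 = x3" by (simp_all add: X_def)
  have X_mult: "(X *v l)$i = X$i \<bullet> l" for l i by (rule matrix_vector_mul_component)
  have X_nondegenerate: "det X \<noteq> 0"
  proof
    assume "det X = 0"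
    then obtain l where "l \<noteq> 0" "X *v l = 0"
      using invertible_det_nz[of X] invertible_left_inverse[of X] matrix_left_invertible_ker[of X] by auto
    moreover from this have "X$i \<bullet> l = 0" for i by (metis X_mult zero_index)
    ultimately have "collinear_points x1 x2 x3"
      unfolding collinear_points_def incident_def X_rows[symmetric] by blast
    then show False using assms(7) by (simp add: general_position_def)
  qed
  have nz: "\<forall>i. (X *v l1)$i \<noteq> 0" "\<forall>i. (X *v l2)$i \<noteq> 0"
    using assms(8-13) by (simp_all add: X_mult forall_3 X_rows)
  \<comment> \<open>the intersection of the lines is off the side through \<open>x\<close> and \<open>y\<close> iff this minor is nonzero\<close>
  have side: "(x \<bullet> l1) * (y \<bullet> l2) \<noteq> (y \<bullet> l1) * (x \<bullet> l2)"
    if "is_side (cross3 x y) x1 x2 x3" for x y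
  proof -
    have "cross3 l1 l2 \<bullet> cross3 x y \<noteq> 0"
      using assms(14)[OF that] by (simp add: incident_def)
    then show ?thesis by (simp add: dot_cross inner_commute mult.commute)
  qed
  have dets: "det X = x1 \<bullet> cross3 x2 x3" "det X = x2 \<bullet> cross3 x3 x1" "det X = x3 \<bullet> cross3 x1 x2"
    by (simp_all add: X_def cross3_def det_3 inner_vec_def sum_3 algebra_simps)
  have "is_side (cross3 x1 x2) x1 x2 x3" "is_side (cross3 x2 x3) x1 x2 x3" "is_side (cross3 x3 x1) x1 x2 x3"
    using X_nondegenerate dets by (auto simp: is_side_def incident_def dot_cross_self)
  note this[THEN side]
  then have minors: "\<forall>i j. i \<noteq> j \<longrightarrow>
      (X *v l1)$i * (X *v l2)$j \<noteq> (X *v l1)$j * (X *v l2)$i"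
    by (auto simp: X_mult X_rows forall_3)
  show ?thesis
  proof
    assume "card (real_solutions x1 x2 x3 l1 l2) = 4"
    \<comment> \<open>a single real solution already forces the sign condition\<close>
    then have "real_solutions x1 x2 x3 l1 l2 \<noteq> {}" by auto
    then obtain w where "\<forall>i. w$i \<noteq> 0" "inscribed_form (w * (X *v l1)) = 0"
      "inscribed_form (w * (X *v l2)) = 0"
      using real_solutions_coordinates[OF X_nondegenerate, of l1 l2] unfolding X_rows by blast
    from common_tangent_signs[OF this(1) nz this(2,3), unfolded X_mult]
    have signs: "sgn ((X$i \<bullet> l1) * (X$i \<bullet> l2)) = sgn ((X$j \<bullet> l1) * (X$j \<bullet> l2))" for i j .
    from signs[of 1 2] signs[of 2 3]
    show "sgn ((x1 \<bullet> l1) * (x1 \<bullet> l2)) = sgn ((x2 \<bullet> l1) * (x2 \<bullet> l2)) \<and>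
      sgn ((x2 \<bullet> l1) * (x2 \<bullet> l2)) = sgn ((x3 \<bullet> l1) * (x3 \<bullet> l2))"
      by (simp only: X_rows simp_thms)
  next
    assume signs: "sgn ((x1 \<bullet> l1) * (x1 \<bullet> l2)) = sgn ((x2 \<bullet> l1) * (x2 \<bullet> l2)) \<and>
      sgn ((x2 \<bullet> l1) * (x2 \<bullet> l2)) = sgn ((x3 \<bullet> l1) * (x3 \<bullet> l2))"
    have "sgn ((X *v l1)$i * (X *v l2)$i) = sgn ((X *v l1)$j * (X *v l2)$j)" for i j
      using signs exhaust_3[of i] exhaust_3[of j] unfolding X_mult
      by (elim disjE; hypsubst) (simp_all only: X_rows)
    from card_real_solutions_eq_4[OF X_nondegenerate nz minors this]
    show "card (real_solutions x1 x2 x3 l1 l2) = 4" by (simp only: X_rows)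
  qed
qed

end
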